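(* Let $\Phi_k:X_k\to E_k$ be a modular parametrization satisfying $$\Phi_k^*\left(\frac{dx}{2y}\right)=\frac{4\pi i}{k}f_{N,k}(2\tau/k)\,d\tau,$$ and let $Q_k(\tau):=x(\tau)\Delta_{N,k}(\tau)^{4/k}$, where $x(\tau)=x\circ\Phi_k(\tau)$. Then $$\partial_{N,k}(Q_k(\tau))^2=\Delta_{N,k}(\tau)^{12/k}f_k(x(\tau)).$$ In particular, $Q_k(\tau)$ is a solution of the corresponding one of the differential equations $$\begin{aligned} \partial_{N,4}(Q_4)^2&=Q_4^3+a_2Q_4^2\Delta_{N,4}+a_4Q_4\Delta_{N,4}^2+a_6\Delta_{N,4}^3 &&(k=4),\\ \partial_{N,6}(Q_6)^2&=Q_6^3+b_6\Delta_{N,6}^2 &&(k=6),\\ \partial_{N,8}(Q_8)^2&=Q_8^3+c_4Q_8\Delta_{N,8} &&(k=8),\\ \partial_{N,12}(Q_{12})^2&=Q_{12}^3+d_6\Delta_{N,12} &&(k=12). \end{aligned}$$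
   Context: Let $N\ge1$ and $k\in\{4,6,8,12\}$. $E_k/\mathbb{Q}$ is an elliptic curve $y^2=f_k(x)$ with $f_4(x)=x^3+a_2x^2+a_4x+a_6$, $f_6(x)=x^3+b_6$, $f_8(x)=x^3+c_4x$, $f_{12}(x)=x^3+d_6$, all coefficients rational, and $j(E_4)\neq0,1728$. $f_{N,k}(\tau)\in S_2(\Gamma_0(\tfrac{k^2}{4}N))$ is a newform with rational Fourier coefficients. $\Gamma_k:=\begin{pmatrix}2/k&0\\0&1\end{pmatrix}^{-1}\Gamma_0\!\left(\tfrac{k^2}{4}N\right)\begin{pmatrix}2/k&0\\0&1\end{pmatrix}=\Gamma_0(\tfrac k2N)\cap\Gamma^0(\tfrac k2)$, and $X_k$ is the compactification of $\mathbb{H}/\Gamma_k$. $\Delta_{N,k}(\tau):=f_{N,k}(2\tau/k)^{k/2}$, with fractional powers understood as $\Delta_{N,k}^{4/k}:=f_{N,k}(2\tau/k)^2$ and $\Delta_{N,k}^{12/k}:=f_{N,k}(2\tau/k)^6$. For a weight $4$ meromorphic modular form $f$ for $\Gamma_k$, $$\partial_{N,k}(f(\tau))=\frac{k}{8\pi i}f'(\tau)-\frac1{2\pi i}f(\tau)\frac{\Delta_{N,k}'(\tau)}{\Delta_{N,k}(\tau)},\qquad '=\frac{d}{d\tau}.$$ *)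

theory Defs
  imports "HOL-Analysis.Analysis" "HOL-Computational_Algebra.Polynomial"
begin

section \<open>The extended upper half plane and congruence subgroups\<close>

definition upper_half_plane :: "complex set" where
  "upper_half_plane = {\<tau>. 0 < Im \<tau>}"

datatype riemann_sphere = Fin complex | Infty

definition extended_half_plane :: "riemann_sphere set" where
  "extended_half_plane = Fin ` upper_half_plane \<union> Fin ` \<rat> \<union> {Infty}"

type_synonym mat2 = "real ^ 2 ^ 2"

definition mat2 :: "real \<Rightarrow> real \<Rightarrow> real \<Rightarrow> real \<Rightarrow> mat2" where
  "mat2 a b c d = vector [vector [a, b], vector [c, d]]"

definition mobius :: "mat2 \<Rightarrow> riemann_sphere \<Rightarrow> riemann_sphere" where
  "mobius A s = (case s of
      Fin z \<Rightarrow> (if of_real (A$2$1) * z + of_real (A$2$2) = 0 then Infty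
               else Fin ((of_real (A$1$1) * z + of_real (A$1$2)) /
                         (of_real (A$2$1) * z + of_real (A$2$2))))
    | Infty \<Rightarrow> (if A$2$1 = 0 then Infty else Fin (of_real (A$1$1) / of_real (A$2$1))))"

definition SL2Z :: "mat2 set" where
  "SL2Z = {A. (\<forall>i j. A$i$j \<in> \<int>) \<and> det A = 1}"

definition Gamma0 :: "nat \<Rightarrow> mat2 set" where
  "Gamma0 M = {A \<in> SL2Z. \<exists>m::int. A$2$1 = real M * of_int m}"

definition Gamma0_upper :: "nat \<Rightarrow> mat2 set" where
  "Gamma0_upper M = {A \<in> SL2Z. \<exists>m::int. A$1$2 = real M * of_int m}"

definition level :: "nat \<Rightarrow> nat \<Rightarrow> nat" where
  "level N k = k\<^sup>2 div 4 * N"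

definition Gamma_k :: "nat \<Rightarrow> nat \<Rightarrow> mat2 set" where
  "Gamma_k N k =
     (let \<alpha> = mat2 (2 / real k) 0 0 1
      in (\<lambda>A. matrix_inv \<alpha> ** A ** \<alpha>) ` Gamma0 (level N k))"

lemma mat2_nth [simp]:
  "mat2 a b c d $ 1 $ 1 = a" "mat2 a b c d $ 1 $ 2 = b"
  "mat2 a b c d $ 2 $ 1 = c" "mat2 a b c d $ 2 $ 2 = d"
  by (simp_all add: mat2_def)

lemma mat2_eqI:
  fixes A B :: mat2
  assumes "A$1$1 = B$1$1" "A$1$2 = B$1$2" "A$2$1 = B$2$1" "A$2$2 = B$2$2"
  shows "A = B"
  using assms by (simp add: vec_eq_iff forall_2)

lemma matrix_mult_2_nth:
  fixes A B :: mat2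
  shows "(A ** B)$i$j = A$i$1 * B$1$j + A$i$2 * B$2$j"
  by (simp add: matrix_matrix_mult_def sum_2)

lemma matrix_inv_diag2:
  assumes "x \<noteq> 0"
  shows "matrix_inv (mat2 x 0 0 1) = mat2 (1 / x) 0 0 1"
proof -
  let ?A = "mat2 x 0 0 1" and ?B = "mat2 (1 / x) 0 0 1"
  have AB: "?A ** ?B = mat 1" and BA: "?B ** ?A = mat 1"
    using assms by (auto intro!: mat2_eqI simp: matrix_mult_2_nth mat_def)
  then have "?A ** matrix_inv ?A = mat 1 \<and> matrix_inv ?A ** ?A = mat 1"
    using someI[where P = "\<lambda>A'. ?A ** A' = mat 1 \<and> A' ** ?A = mat 1" and x = ?B]
    unfolding matrix_inv_def by blast
  then have inv: "matrix_inv ?A ** ?A = mat 1" by blast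
  have "matrix_inv ?A = matrix_inv ?A ** (?A ** ?B)" by (simp only: AB matrix_mul_rid)
  also have "\<dots> = ?B" by (simp only: matrix_mul_assoc inv matrix_mul_lid)
  finally show ?thesis .
qed

lemma Gamma_k_eq:
  assumes "even k" "k > 0"
  shows "Gamma_k N k = Gamma0 (k div 2 * N) \<inter> Gamma0_upper (k div 2)"
proof -
  obtain m where k: "k = 2 * m" and m: "m > 0"
    using assms by (auto elim: evenE)
  define \<alpha> where "\<alpha> = mat2 (2 / real k) 0 0 1"
  have lev: "level N k = m * m * N"
    by (simp add: level_def k power2_eq_square)
  have inv: "matrix_inv \<alpha> = mat2 (real m) 0 0 1"
    using m by (simp add: \<alpha>_def k matrix_inv_diag2)
  have conj: "matrix_inv \<alpha> ** A ** \<alpha> = mat2 (A$1$1) (real m * A$1$2) (A$2$1 / real m) (A$2$2)" for A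
    unfolding inv using m
    by (intro mat2_eqI) (simp_all add: matrix_mult_2_nth \<alpha>_def k)
  have SL: "A \<in> SL2Z \<longleftrightarrow> (A$1$1 \<in> \<int> \<and> A$1$2 \<in> \<int> \<and> A$2$1 \<in> \<int> \<and> A$2$2 \<in> \<int>) \<and>
              A$1$1 * A$2$2 - A$1$2 * A$2$1 = 1" for A
    unfolding SL2Z_def det_2 mem_Collect_eq forall_2 by blast
  have "mat2 (A$1$1) (real m * A$1$2) (A$2$1 / real m) (A$2$2)
          \<in> Gamma0 (m * N) \<inter> Gamma0_upper m" if A: "A \<in> Gamma0 (m * m * N)" for A
  proof -
    obtain l :: int where l: "A$2$1 = real (m * m * N) * of_int l"
      using A unfolding Gamma0_def by blast
    have A': "A \<in> SL2Z" using A unfolding Gamma0_def by blast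
    obtain b :: int where b: "A$1$2 = of_int b" using A' SL Ints_cases by metis
    have eq: "A$2$1 / real m = real (m * N) * of_int l" using m by (simp add: l)
    have "A$2$1 / real m \<in> \<int>" unfolding eq by (intro Ints_mult Ints_of_nat Ints_of_int)
    moreover have "real m * A$1$2 \<in> \<int>"
      unfolding b by (intro Ints_mult Ints_of_nat Ints_of_int)
    moreover have "(real m * A$1$2) * (A$2$1 / real m) = A$1$2 * A$2$1" using m by simp
    ultimately have "mat2 (A$1$1) (real m * A$1$2) (A$2$1 / real m) (A$2$2) \<in> SL2Z"
      using A' unfolding SL mat2_nth by presburger
    then show ?thesis
      unfolding Gamma0_def Gamma0_upper_def mem_Collect_eq Int_iff mat2_nth
      using eq b by metis
  qed
  moreover have "B \<in> (\<lambda>A. matrix_inv \<alpha> ** A ** \<alpha>) ` Gamma0 (m * m * N)"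
    if B: "B \<in> Gamma0 (m * N) \<inter> Gamma0_upper m" for B
  proof -
    obtain l :: int where l: "B$2$1 = real (m * N) * of_int l"
      using B unfolding Gamma0_def by blast
    obtain b :: int where b: "B$1$2 = real m * of_int b"
      using B unfolding Gamma0_upper_def by blast
    have B': "B \<in> SL2Z" using B unfolding Gamma0_def by blast
    define A where "A = mat2 (B$1$1) (of_int b) (real m * B$2$1) (B$2$2)"
    have eq: "real m * B$2$1 = real (m * m * N) * of_int l" by (simp add: l)
    have "real m * B$2$1 \<in> \<int>" unfolding eq by (intro Ints_mult Ints_of_nat Ints_of_int)
    moreover have "of_int b * (real m * B$2$1) = B$1$2 * B$2$1" by (simp add: b)
    moreover have "(of_int b :: real) \<in> \<int>" by (rule Ints_of_int)
    ultimately have "A \<in> SL2Z"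
      using B' unfolding SL A_def mat2_nth by presburger
    then have "A \<in> Gamma0 (m * m * N)"
      unfolding Gamma0_def mem_Collect_eq using eq unfolding A_def mat2_nth by metis
    moreover have "matrix_inv \<alpha> ** A ** \<alpha> = B"
      unfolding conj using m by (intro mat2_eqI) (simp_all add: A_def b)
    ultimately show ?thesis by blast
  qed
  ultimately have "(\<lambda>A. matrix_inv \<alpha> ** A ** \<alpha>) ` Gamma0 (m * m * N) =
      Gamma0 (m * N) \<inter> Gamma0_upper m"
    unfolding conj by blast
  then show ?thesis
    unfolding Gamma_k_def Let_def \<alpha>_def[symmetric] lev by (simp add: k)
qed


section \<open>Cusp forms and newforms for \<open>\<Gamma>\<^sub>0(M)\<close> (trivial character)\<close>

text \<open>Modular forms are functions on all of \<^typ>\<open>complex\<close>; their values outside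
  the upper half plane are irrelevant.\<close>

definition slash :: "nat \<Rightarrow> mat2 \<Rightarrow> (complex \<Rightarrow> complex) \<Rightarrow> complex \<Rightarrow> complex" where
  "slash w A f \<tau> =
     f ((of_real (A$1$1) * \<tau> + of_real (A$1$2)) / (of_real (A$2$1) * \<tau> + of_real (A$2$2)))
       / (of_real (A$2$1) * \<tau> + of_real (A$2$2)) ^ w"

definition has_fourier_expansion :: "(complex \<Rightarrow> complex) \<Rightarrow> nat \<Rightarrow> (nat \<Rightarrow> complex) \<Rightarrow> bool" where
  "has_fourier_expansion f h a \<longleftrightarrow>
     (\<forall>\<tau>\<in>upper_half_plane.
        (\<lambda>n. a n * exp (2 * of_real pi * \<i> * of_nat n * \<tau> / of_nat h)) sums f \<tau>)"

definition cusp_forms :: "nat \<Rightarrow> nat \<Rightarrow> (complex \<Rightarrow> complex) set" where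
  "cusp_forms M w =
     {f. f holomorphic_on upper_half_plane \<and>
         (\<forall>A\<in>Gamma0 M. \<forall>\<tau>\<in>upper_half_plane. slash w A f \<tau> = f \<tau>) \<and>
         (\<forall>A\<in>SL2Z. \<exists>h>0. \<exists>a. a 0 = 0 \<and> has_fourier_expansion (slash w A f) h a)}"

text \<open>\<open>T\<^sub>n\<close> as the sum over the matrices with rows \<open>(n/d, b)\<close>, \<open>(0, d)\<close>, where \<open>0 \<le> b < d\<close> and
  \<open>n/d\<close> is prime to \<open>M\<close>.\<close>

definition hecke :: "nat \<Rightarrow> nat \<Rightarrow> nat \<Rightarrow> (complex \<Rightarrow> complex) \<Rightarrow> complex \<Rightarrow> complex" where
  "hecke M w n f \<tau> = of_nat n ^ (w - 1) *
     (\<Sum>d | d dvd n \<and> coprime (n div d) M.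
        (\<Sum>b<d. f ((of_nat (n div d) * \<tau> + of_nat b) / of_nat d)) / of_nat d ^ w)"

definition fundamental_domain :: "complex set" where
  "fundamental_domain = {\<tau>. 0 < Im \<tau> \<and> \<bar>Re \<tau>\<bar> \<le> 1 / 2 \<and> 1 \<le> cmod \<tau>}"

text \<open>A fundamental domain for \<open>\<Gamma>\<^sub>0(M)\<close> is covered by the translates of the standard one
  by representatives \<open>A\<close> of the cosets \<open>\<Gamma>\<^sub>0(M) A\<close> in \<open>SL\<^sub>2(\<int>)\<close>; the usual normalisation
  by the volume is omitted.\<close>

definition petersson ::
    "nat \<Rightarrow> nat \<Rightarrow> (complex \<Rightarrow> complex) \<Rightarrow> (complex \<Rightarrow> complex) \<Rightarrow> complex" where
  "petersson M w f g =
     (\<Sum>C \<in> (\<lambda>A. (\<lambda>B. B ** A) ` Gamma0 M) ` SL2Z.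
        let A = (SOME A. A \<in> C) in
        set_lebesgue_integral lborel fundamental_domain
          (\<lambda>\<tau>. slash w A f \<tau> * cnj (slash w A g \<tau>) * of_real (Im \<tau> ^ w / (Im \<tau>)\<^sup>2)))"

inductive_set oldforms :: "nat \<Rightarrow> nat \<Rightarrow> (complex \<Rightarrow> complex) set" for M w :: nat where
  zero: "(\<lambda>\<tau>. 0) \<in> oldforms M w"
| add: "f \<in> oldforms M w \<Longrightarrow> d * M' dvd M \<Longrightarrow> M' \<noteq> M \<Longrightarrow> g \<in> cusp_forms M' w \<Longrightarrow>
        (\<lambda>\<tau>. f \<tau> + c * g (of_nat d * \<tau>)) \<in> oldforms M w"

definition newform :: "nat \<Rightarrow> nat \<Rightarrow> (complex \<Rightarrow> complex) \<Rightarrow> bool" where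
  "newform M w f \<longleftrightarrow>
     f \<in> cusp_forms M w \<and>
     (\<forall>g\<in>oldforms M w. petersson M w f g = 0) \<and>
     (\<forall>n>0. \<exists>c. \<forall>\<tau>\<in>upper_half_plane. hecke M w n f \<tau> = c * f \<tau>) \<and>
     (\<exists>a. has_fourier_expansion f 1 a \<and> a 1 = 1)"

definition rational_fourier_coefficients :: "(complex \<Rightarrow> complex) \<Rightarrow> bool" where
  "rational_fourier_coefficients f \<longleftrightarrow> (\<exists>a. has_fourier_expansion f 1 a \<and> (\<forall>n. a n \<in> \<rat>))"


section \<open>Elliptic curves \<open>y\<^sup>2 = p(x)\<close> with \<open>p\<close> a monic rational cubic\<close>

text \<open>The standard quantities \<open>b\<^sub>2, b\<^sub>4, b\<^sub>6, b\<^sub>8\<close> with \<open>a\<^sub>1 = a\<^sub>3 = 0\<close>.\<close>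

definition weierstrass_disc :: "rat poly \<Rightarrow> rat" where
  "weierstrass_disc p =
     (let a2 = coeff p 2; a4 = coeff p 1; a6 = coeff p 0;
          b2 = 4 * a2; b4 = 2 * a4; b6 = 4 * a6; b8 = 4 * a2 * a6 - a4\<^sup>2
      in - b2\<^sup>2 * b8 - 8 * b4 ^ 3 - 27 * b6\<^sup>2 + 9 * b2 * b4 * b6)"

definition j_invariant :: "rat poly \<Rightarrow> rat" where
  "j_invariant p =
     (let b2 = 4 * coeff p 2; b4 = 2 * coeff p 1
      in (b2\<^sup>2 - 24 * b4) ^ 3 / weierstrass_disc p)"

definition elliptic_curve :: "rat poly \<Rightarrow> bool" where
  "elliptic_curve p \<longleftrightarrow> degree p = 3 \<and> lead_coeff p = 1 \<and> weierstrass_disc p \<noteq> 0"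

definition cpoly :: "rat poly \<Rightarrow> complex poly" where
  "cpoly p = map_poly of_rat p"

datatype curve_point = Origin | Affine (xcoord: complex) (ycoord: complex)

definition curve_points :: "rat poly \<Rightarrow> curve_point set" where
  "curve_points p = insert Origin {Affine x y | x y. y\<^sup>2 = poly (cpoly p) x}"

text \<open>\<open>Affine x y\<close> is the point \<open>[x : y : 1]\<close> of the projective plane and
  \<open>Origin\<close> is \<open>[0 : 1 : 0]\<close>.\<close>

definition homogeneous_coords ::
    "curve_point \<Rightarrow> complex \<Rightarrow> complex \<Rightarrow> complex \<Rightarrow> bool" where
  "homogeneous_coords P X Y Z = (case P of
      Origin \<Rightarrow> X = 0 \<and> Y \<noteq> 0 \<and> Z = 0
    | Affine x y \<Rightarrow> Z \<noteq> 0 \<and> X = x * Z \<and> Y = y * Z)"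

text \<open>Holomorphic maps from an open set into the curve, as a closed submanifold of the
  complex projective plane.\<close>

definition curve_holomorphic_on :: "(complex \<Rightarrow> curve_point) \<Rightarrow> complex set \<Rightarrow> bool" where
  "curve_holomorphic_on \<phi> U \<longleftrightarrow>
     (\<forall>z\<in>U. \<exists>V X Y Z. open V \<and> z \<in> V \<and> V \<subseteq> U \<and>
        X holomorphic_on V \<and> Y holomorphic_on V \<and> Z holomorphic_on V \<and>
        (\<forall>q\<in>V. homogeneous_coords (\<phi> q) (X q) (Y q) (Z q)))"

text \<open>The coefficient \<open>g\<close> in \<open>\<phi>\<^sup>*(dx/2y) = g(\<tau>) d\<tau>\<close>. The form \<open>dx/2y\<close> is holomorphic on the
  whole curve: it is \<open>dy/p'(x)\<close> where \<open>y = 0\<close>, and equals \<open>-du\<close> at the origin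
  for the local parameter \<open>u = x/y\<close>.\<close>

definition pullback_dx_2y :: "rat poly \<Rightarrow> (complex \<Rightarrow> curve_point) \<Rightarrow> complex \<Rightarrow> complex" where
  "pullback_dx_2y p \<phi> \<tau> = (case \<phi> \<tau> of
      Affine x y \<Rightarrow>
        (if y \<noteq> 0 then deriv (\<lambda>z. xcoord (\<phi> z)) \<tau> / (2 * y)
         else deriv (\<lambda>z. ycoord (\<phi> z)) \<tau> / poly (pderiv (cpoly p)) x)
    | Origin \<Rightarrow> - deriv (\<lambda>z. case \<phi> z of Affine x y \<Rightarrow> x / y | Origin \<Rightarrow> 0) \<tau>)"


section \<open>The compact modular curve and modular parametrizations\<close>

definition orbit :: "mat2 set \<Rightarrow> riemann_sphere \<Rightarrow> riemann_sphere set" where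
  "orbit \<Gamma> s = (\<lambda>A. mobius A s) ` \<Gamma>"

definition modular_curve :: "mat2 set \<Rightarrow> riemann_sphere set set" where
  "modular_curve \<Gamma> = orbit \<Gamma> ` extended_half_plane"

text \<open>Order of the image of the stabilizer in \<open>PSL\<^sub>2\<close>.\<close>

definition elliptic_period :: "mat2 set \<Rightarrow> complex \<Rightarrow> nat" where
  "elliptic_period \<Gamma> \<tau> = card ((\<lambda>A. {A, - A}) ` {A\<in>\<Gamma>. mobius A (Fin \<tau>) = Fin \<tau>})"

text \<open>Width of the cusp \<open>\<delta>\<infinity>\<close>.\<close>

definition cusp_width :: "mat2 set \<Rightarrow> mat2 \<Rightarrow> nat" where
  "cusp_width \<Gamma> \<delta> =
     (LEAST h. h > 0 \<and> (let T = \<delta> ** mat2 1 (real h) 0 1 ** matrix_inv \<delta> in T \<in> \<Gamma> \<or> - T \<in> \<Gamma>))"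

text \<open>Local coordinates of the compact Riemann surface, pulled back to the half plane: at the
  image of \<open>\<tau>0\<close>, and at the cusp \<open>\<delta>\<infinity>\<close> (the latter as a function of \<open>\<delta>\<^sup>-\<^sup>1\<tau>\<close>).\<close>

definition inner_coord :: "mat2 set \<Rightarrow> complex \<Rightarrow> complex \<Rightarrow> complex" where
  "inner_coord \<Gamma> \<tau>0 \<tau> = ((\<tau> - \<tau>0) / (\<tau> - cnj \<tau>0)) ^ elliptic_period \<Gamma> \<tau>0"

definition cusp_coord :: "mat2 set \<Rightarrow> mat2 \<Rightarrow> complex \<Rightarrow> complex" where
  "cusp_coord \<Gamma> \<delta> \<tau> = exp (2 * of_real pi * \<i> * \<tau> / of_nat (cusp_width \<Gamma> \<delta>))"

definition holomorphic_at_inner ::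
    "mat2 set \<Rightarrow> (riemann_sphere set \<Rightarrow> curve_point) \<Rightarrow> complex \<Rightarrow> bool" where
  "holomorphic_at_inner \<Gamma> \<Phi> \<tau>0 \<longleftrightarrow>
     (\<exists>r>0. \<exists>\<phi>. curve_holomorphic_on \<phi> (ball 0 r) \<and>
        (\<forall>\<tau>\<in>upper_half_plane. cmod (inner_coord \<Gamma> \<tau>0 \<tau>) < r \<longrightarrow>
           \<Phi> (orbit \<Gamma> (Fin \<tau>)) = \<phi> (inner_coord \<Gamma> \<tau>0 \<tau>)))"

definition holomorphic_at_cusp ::
    "mat2 set \<Rightarrow> (riemann_sphere set \<Rightarrow> curve_point) \<Rightarrow> mat2 \<Rightarrow> bool" where
  "holomorphic_at_cusp \<Gamma> \<Phi> \<delta> \<longleftrightarrow>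
     (\<exists>r>0. \<exists>\<phi>. curve_holomorphic_on \<phi> (ball 0 r) \<and>
        \<Phi> (orbit \<Gamma> (mobius \<delta> Infty)) = \<phi> 0 \<and>
        (\<forall>\<tau>\<in>upper_half_plane. cmod (cusp_coord \<Gamma> \<delta> \<tau>) < r \<longrightarrow>
           \<Phi> (orbit \<Gamma> (mobius \<delta> (Fin \<tau>))) = \<phi> (cusp_coord \<Gamma> \<delta> \<tau>)))"

text \<open>Nonconstant holomorphic maps of compact Riemann surfaces.\<close>

definition modular_parametrization ::
    "mat2 set \<Rightarrow> rat poly \<Rightarrow> (riemann_sphere set \<Rightarrow> curve_point) \<Rightarrow> bool" where
  "modular_parametrization \<Gamma> p \<Phi> \<longleftrightarrow>
     \<Phi> ` modular_curve \<Gamma> \<subseteq> curve_points p \<and>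
     (\<forall>\<tau>\<in>upper_half_plane. holomorphic_at_inner \<Gamma> \<Phi> \<tau>) \<and>
     (\<forall>\<delta>\<in>SL2Z. holomorphic_at_cusp \<Gamma> \<Phi> \<delta>) \<and>
     \<not> \<Phi> constant_on modular_curve \<Gamma>"


section \<open>The differential equations\<close>

definition cubic_k ::
    "nat \<Rightarrow> rat \<Rightarrow> rat \<Rightarrow> rat \<Rightarrow> rat \<Rightarrow> rat \<Rightarrow> rat \<Rightarrow> rat poly" where
  "cubic_k k a2 a4 a6 b6 c4 d6 =
     (if k = 4 then [:a6, a4, a2, 1:]
      else if k = 6 then [:b6, 0, 0, 1:]
      else if k = 8 then [:0, c4, 0, 1:]
      else [:d6, 0, 0, 1:])"

definition lift_to_half_plane ::
    "mat2 set \<Rightarrow> (riemann_sphere set \<Rightarrow> curve_point) \<Rightarrow> complex \<Rightarrow> curve_point" where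
  "lift_to_half_plane \<Gamma> \<Phi> \<tau> = \<Phi> (orbit \<Gamma> (Fin \<tau>))"

definition rescaled :: "nat \<Rightarrow> (complex \<Rightarrow> complex) \<Rightarrow> complex \<Rightarrow> complex" where
  "rescaled k f \<tau> = f (2 * \<tau> / of_nat k)"

definition Delta :: "nat \<Rightarrow> (complex \<Rightarrow> complex) \<Rightarrow> complex \<Rightarrow> complex" where
  "Delta k f \<tau> = rescaled k f \<tau> ^ (k div 2)"

text \<open>By convention \<open>\<Delta>\<^bsup>4/k\<^esup>\<close> and \<open>\<Delta>\<^bsup>12/k\<^esup>\<close> denote the following powers of the rescaled newform.\<close>

definition Delta_pow_4_k :: "nat \<Rightarrow> (complex \<Rightarrow> complex) \<Rightarrow> complex \<Rightarrow> complex" where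
  "Delta_pow_4_k k f \<tau> = rescaled k f \<tau> ^ 2"

definition Delta_pow_12_k :: "nat \<Rightarrow> (complex \<Rightarrow> complex) \<Rightarrow> complex \<Rightarrow> complex" where
  "Delta_pow_12_k k f \<tau> = rescaled k f \<tau> ^ 6"

text \<open>Defined pointwise. At a zero of \<open>\<Delta>\<close> the quotient \<open>\<Delta>'/\<Delta>\<close> is \<open>0\<close> here; for
  \<open>h = x \<Delta>\<^bsup>4/k\<^esup>\<close> with \<open>x\<close> finite the product \<open>h \<Delta>'/\<Delta>\<close> has a removable singularity there
  with value \<open>0\<close>, so the formula still agrees with the meromorphic function it denotes.\<close>

definition modular_derivative ::
    "nat \<Rightarrow> (complex \<Rightarrow> complex) \<Rightarrow> (complex \<Rightarrow> complex) \<Rightarrow> complex \<Rightarrow> complex" where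
  "modular_derivative k f h \<tau> =
     of_nat k / (8 * of_real pi * \<i>) * deriv h \<tau>
     - 1 / (2 * of_real pi * \<i>) * h \<tau> * (deriv (Delta k f) \<tau> / Delta k f \<tau>)"

definition Q_k :: "nat \<Rightarrow> (complex \<Rightarrow> complex) \<Rightarrow> (complex \<Rightarrow> curve_point) \<Rightarrow> complex \<Rightarrow> complex" where
  "Q_k k f \<phi> \<tau> = xcoord (\<phi> \<tau>) * Delta_pow_4_k k f \<tau>"

end

theory Submission
  imports Defs
begin

text \<open>
  Write \<open>g(\<tau>) = f(2\<tau>/k)\<close>, so that \<open>\<Delta> = g\<^bsup>k/2\<^esup>\<close> and \<open>Q = x g\<^sup>2\<close>. The logarithmic derivative
  \<open>\<Delta>'/\<Delta> = (k/2) g'/g\<close> is weighted in the modular derivative so that the terms with \<open>g'\<close> cancel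
  and only \<open>(k/8\<pi>i) x' g\<^sup>2\<close> is left (\<open>modular_derivative_Q_k\<close>). The condition on the pullback
  of \<open>dx/2y\<close> reads \<open>x' = 2y (4\<pi>i/k) g\<close> (\<open>deriv_xcoord_eq_pullback\<close>), so the modular derivative
  of \<open>Q\<close> is \<open>y g\<^sup>3\<close>. Its square is \<open>y\<^sup>2 g\<^sup>6 = p(x) g\<^sup>6\<close>, and distributing the powers of \<open>g\<close> over the
  monomials of \<open>p\<close> gives the four differential equations.

  Two points need an argument. First, \<open>x\<close> and \<open>y\<close> must be holomorphic in \<open>\<tau>\<close> away from the poles.
  The parametrization is holomorphic in a local coordinate of the modular curve, and
  this coordinate is a power of \<open>(\<tau> - \<tau>\<^sub>0) / (\<tau> - cnj \<tau>\<^sub>0)\<close> whose exponent is the order of a stabilizer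
  in \<open>PSL\<^sub>2\<close>; it vanishes at \<open>\<tau>\<^sub>0\<close>, and hence describes a neighbourhood of \<open>\<tau>\<^sub>0\<close>, only because
  stabilizers of points of the upper half plane are finite (\<open>elliptic_period_pos\<close>). Secondly, where
  \<open>y = 0\<close> the differential is expressed by \<open>dy\<close> and says nothing about \<open>x'\<close> directly; there
  \<open>2 y y' = p'(x) x'\<close> and the absence of double roots force \<open>x' = 0\<close>.
\<close>

section \<open>Points with finite stabilizer and the local coordinate\<close>

lemma Gamma_k_subset_SL2Z:
  assumes "even k" "k > 0"
  shows "Gamma_k N k \<subseteq> SL2Z"
  using assms by (auto simp: Gamma_k_eq Gamma0_def)

lemma mat_1_in_Gamma_k:
  assumes "even k" "k > 0"
  shows "mat 1 \<in> Gamma_k N k"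
proof -
  have entries: "(mat 1 :: mat2) $ 1 $ 2 = 0" "(mat 1 :: mat2) $ 2 $ 1 = 0"
    by (simp_all add: mat_def)
  have "(mat 1 :: mat2) \<in> SL2Z"
    by (simp add: SL2Z_def det_2 mat_def)
  then show ?thesis
    unfolding Gamma_k_eq[OF assms] Gamma0_def Gamma0_upper_def
    using entries by (auto intro: exI[of _ 0])
qed

text \<open>If \<open>A\<close> fixes \<open>\<tau>\<close>, then the vector \<open>(\<tau>, 1)\<close> is an eigenvector of \<open>A\<close> with
  eigenvalue \<open>l = c \<tau> + d\<close>. As \<open>A\<close> is real, \<open>cnj l\<close> is the other eigenvalue, so \<open>|l|\<^sup>2 = det A = 1\<close>.
  The two complex equations \<open>c \<tau> + d = l\<close> and \<open>a \<tau> + b = \<tau> l\<close> then bound all four real entries.\<close>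

lemma stabilizer_entries_bounded:
  assumes A: "A \<in> SL2Z" and tau: "0 < Im \<tau>" and fixed: "mobius A (Fin \<tau>) = Fin \<tau>"
  shows "\<bar>A$i$j\<bar> \<le> (1 + cmod \<tau>)\<^sup>2 / Im \<tau> + (1 + cmod \<tau>)"
proof -
  define a b c d where "a = A$1$1" and "b = A$1$2" and "c = A$2$1" and "d = A$2$2"
  note abcd = a_def b_def c_def d_def
  define l where "l = of_real c * \<tau> + of_real d"
  define R where "R = 1 + cmod \<tau>"
  have det: "a * d - b * c = 1"
    using A by (simp add: SL2Z_def det_2 abcd)
  have "l \<noteq> 0" and "(of_real a * \<tau> + of_real b) / l = \<tau>"
    using fixed by (auto simp: mobius_def l_def abcd split: if_splits)
  then have eig: "of_real a * \<tau> + of_real b = \<tau> * l"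
    by (simp add: field_simps)
  \<comment> \<open>The imaginary part of \<open>cnj l * (a \<tau> + b) = \<tau> * |l|\<^sup>2\<close> compares \<open>det A * Im \<tau>\<close> with \<open>|l|\<^sup>2 * Im \<tau>\<close>.\<close>
  have "Im ((of_real a * \<tau> + of_real b) * cnj l) = (a * d - b * c) * Im \<tau>"
    by (simp add: l_def algebra_simps)
  moreover have "Im ((of_real a * \<tau> + of_real b) * cnj l) = Im \<tau> * (cmod l)\<^sup>2"
    unfolding eig mult.assoc complex_norm_square[symmetric] by simp
  ultimately have l1: "cmod l = 1"
    using det tau by (simp add: power2_eq_1_iff)
      (metis norm_ge_zero abs_of_nonneg abs_1 power2_eq_1_iff abs_minus_cancel)
  have R: "1 \<le> R" "cmod \<tau> \<le> R" by (simp_all add: R_def)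
  have sq: "R \<le> R\<^sup>2" using R(1) by (simp add: power2_eq_square)
  have "\<bar>c * Im \<tau>\<bar> \<le> 1"
    using abs_Im_le_cmod[of l] l1 by (simp add: l_def)
  then have c: "\<bar>c\<bar> \<le> 1 / Im \<tau>"
    using tau by (simp add: abs_mult field_simps)
  have "\<bar>a * Im \<tau>\<bar> \<le> cmod \<tau>"
    using abs_Im_le_cmod[of "\<tau> * l"] l1 unfolding norm_mult by (simp add: eig[symmetric])
  then have a: "\<bar>a\<bar> \<le> cmod \<tau> / Im \<tau>"
    using tau by (simp add: abs_mult field_simps)
  have "cmod (of_real d) \<le> cmod l + cmod (of_real c * \<tau>)"
    unfolding l_def by (metis add_diff_cancel_left' norm_triangle_ineq4)
  then have d: "\<bar>d\<bar> \<le> 1 + \<bar>c\<bar> * cmod \<tau>"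
    using l1 by (simp add: norm_mult)
  have "cmod (of_real b) \<le> cmod (\<tau> * l) + cmod (of_real a * \<tau>)"
    unfolding eig[symmetric] by (metis add_diff_cancel_left' norm_triangle_ineq4)
  then have b: "\<bar>b\<bar> \<le> cmod \<tau> + \<bar>a\<bar> * cmod \<tau>"
    using l1 by (simp add: norm_mult)
  have bound: "s * t / Im \<tau> \<le> R\<^sup>2 / Im \<tau>" if "0 \<le> s" "s \<le> R" "0 \<le> t" "t \<le> R" for s t
    using tau R that by (simp add: divide_right_mono power2_eq_square mult_mono)
  have "\<bar>c\<bar> \<le> R\<^sup>2 / Im \<tau>" using c bound[of 1 1] R by simp
  moreover have "\<bar>a\<bar> \<le> R\<^sup>2 / Im \<tau>" using a bound[of "cmod \<tau>" 1] R by simp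
  moreover have "\<bar>d\<bar> \<le> R + R\<^sup>2 / Im \<tau>"
    using d mult_right_mono[OF c, of "cmod \<tau>"] bound[of 1 "cmod \<tau>"] R by simp
  moreover have "\<bar>b\<bar> \<le> R + R\<^sup>2 / Im \<tau>"
    using b mult_right_mono[OF a, of "cmod \<tau>"] bound[of "cmod \<tau>" "cmod \<tau>"] R by simp
  ultimately have "\<forall>i j. \<bar>A$i$j\<bar> \<le> R\<^sup>2 / Im \<tau> + R"
    using R unfolding forall_2 abcd by auto
  then show ?thesis by (simp add: R_def)
qed

lemma finite_stabilizer:
  assumes "\<Gamma> \<subseteq> SL2Z" "0 < Im \<tau>"
  shows "finite {A\<in>\<Gamma>. mobius A (Fin \<tau>) = Fin \<tau>}"
proof -
  define B where "B = (1 + cmod \<tau>)\<^sup>2 / Im \<tau> + (1 + cmod \<tau>)"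
  let ?I = "{x::real. x \<in> \<int> \<and> \<bar>x\<bar> \<le> B}"
  have fin: "finite ?I"
    by (rule finite_abs_int_segment)
  have "A \<in> (\<lambda>(a,b,c,d). mat2 a b c d) ` (?I \<times> ?I \<times> ?I \<times> ?I)"
    if "A \<in> \<Gamma>" "mobius A (Fin \<tau>) = Fin \<tau>" for A
  proof -
    have "A$i$j \<in> ?I" for i j
      using stabilizer_entries_bounded[of A \<tau> i j] that assms by (auto simp: B_def SL2Z_def)
    moreover have "A = mat2 (A$1$1) (A$1$2) (A$2$1) (A$2$2)"
      by (intro mat2_eqI) simp_all
    ultimately show ?thesis by (intro image_eqI[where x = "(A$1$1, A$1$2, A$2$1, A$2$2)"]) auto
  qed
  then have "{A\<in>\<Gamma>. mobius A (Fin \<tau>) = Fin \<tau>} \<subseteq> (\<lambda>(a,b,c,d). mat2 a b c d) ` (?I \<times> ?I \<times> ?I \<times> ?I)"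
    by blast
  then show ?thesis
    by (rule finite_subset) (intro finite_imageI finite_cartesian_product fin)
qed

text \<open>An infinite stabilizer would have cardinality \<open>0\<close>, and the local coordinate \<open>inner_coord\<close> would
  degenerate to the constant \<open>1\<close>.\<close>

lemma elliptic_period_pos:
  assumes "\<Gamma> \<subseteq> SL2Z" "mat 1 \<in> \<Gamma>" "0 < Im \<tau>"
  shows "0 < elliptic_period \<Gamma> \<tau>"
proof -
  have "mobius (mat 1) (Fin \<tau>) = Fin \<tau>"
    by (simp add: mobius_def mat_def)
  then have "{A\<in>\<Gamma>. mobius A (Fin \<tau>) = Fin \<tau>} \<noteq> {}"
    using assms(2) by blast
  then show ?thesis
    unfolding elliptic_period_def card_gt_0_iff
    using finite_stabilizer[OF assms(1,3)] by simp
qed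


section \<open>Affine coordinates of a holomorphic map into the curve\<close>

text \<open>At a point other than \<open>Origin\<close> the homogeneous coordinate \<open>Z\<close> is nonzero, and it stays
  nonzero nearby; the affine coordinates are the quotients \<open>X/Z\<close> and \<open>Y/Z\<close> of holomorphic
  functions, although \<open>X\<close>, \<open>Y\<close> and \<open>Z\<close> themselves are not determined by the map.\<close>

lemma curve_holomorphic_on_affine_coords:
  assumes hol: "curve_holomorphic_on \<phi> U" and q: "q \<in> U" and fin: "\<phi> q \<noteq> Origin"
  obtains V where "open V" "q \<in> V" "V \<subseteq> U" "\<And>z. z \<in> V \<Longrightarrow> \<phi> z \<noteq> Origin"
    "(\<lambda>z. xcoord (\<phi> z)) holomorphic_on V" "(\<lambda>z. ycoord (\<phi> z)) holomorphic_on V"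
proof -
  obtain W X Y Z where W: "open W" "q \<in> W" "W \<subseteq> U"
    and XYZ: "X holomorphic_on W" "Y holomorphic_on W" "Z holomorphic_on W"
    and hom: "\<And>z. z \<in> W \<Longrightarrow> homogeneous_coords (\<phi> z) (X z) (Y z) (Z z)"
    using hol q unfolding curve_holomorphic_on_def by metis
  define V where "V = {z \<in> W. Z z \<noteq> 0}"
  have V: "open V" unfolding V_def
    using continuous_open_preimage[OF holomorphic_on_imp_continuous_on[OF XYZ(3)] W(1), of "- {0}"]
    by (simp add: vimage_def Int_def open_Compl)
  have sub: "V \<subseteq> W" by (auto simp: V_def)
  have aff: "\<phi> z \<noteq> Origin \<and> xcoord (\<phi> z) = X z / Z z \<and> ycoord (\<phi> z) = Y z / Z z" if "z \<in> V" for z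
    using hom[of z] that by (auto simp: V_def homogeneous_coords_def split: curve_point.splits)
  show thesis
  proof (rule that[OF V])
    show "q \<in> V"
      using hom[OF W(2)] fin W(2) by (auto simp: V_def homogeneous_coords_def split: curve_point.splits)
    show "V \<subseteq> U" using sub W(3) by blast
    show "\<phi> z \<noteq> Origin" if "z \<in> V" for z using aff that by blast
    have quot: "(\<lambda>z. T z / Z z) holomorphic_on V" if "T holomorphic_on W" for T
      using that XYZ(3) sub
      by (intro holomorphic_on_divide) (auto intro: holomorphic_on_subset simp: V_def)
    show "(\<lambda>z. xcoord (\<phi> z)) holomorphic_on V"
      using quot[OF XYZ(1)] aff by (simp cong: holomorphic_cong)
    show "(\<lambda>z. ycoord (\<phi> z)) holomorphic_on V"
      using quot[OF XYZ(2)] aff by (simp cong: holomorphic_cong)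
  qed
qed

lemma open_upper_half_plane: "open upper_half_plane"
  unfolding upper_half_plane_def by (rule open_halfspace_Im_gt)

text \<open>The affine coordinates near \<open>\<tau>0\<close> are those of the map on the modular curve, composed with the
  local coordinate. The latter is holomorphic on the whole half plane and takes \<open>\<tau>0\<close> to \<open>0\<close>, so
  the preimage of a small disc around \<open>0\<close> is a neighbourhood of \<open>\<tau>0\<close>.\<close>

lemma parametrization_affine_coords:
  assumes hol: "holomorphic_at_inner \<Gamma> \<Phi> \<tau>0"
    and \<Gamma>: "\<Gamma> \<subseteq> SL2Z" "mat 1 \<in> \<Gamma>"
    and \<tau>0: "\<tau>0 \<in> upper_half_plane"
    and fin: "lift_to_half_plane \<Gamma> \<Phi> \<tau>0 \<noteq> Origin"
  obtains V where "open V" "\<tau>0 \<in> V" "V \<subseteq> upper_half_plane"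
    "\<And>\<tau>. \<tau> \<in> V \<Longrightarrow> lift_to_half_plane \<Gamma> \<Phi> \<tau> \<noteq> Origin"
    "(\<lambda>\<tau>. xcoord (lift_to_half_plane \<Gamma> \<Phi> \<tau>)) holomorphic_on V"
    "(\<lambda>\<tau>. ycoord (lift_to_half_plane \<Gamma> \<Phi> \<tau>)) holomorphic_on V"
proof -
  define u where "u = inner_coord \<Gamma> \<tau>0"
  let ?H = "upper_half_plane"
  obtain r \<phi> where r: "r > 0" and \<phi>: "curve_holomorphic_on \<phi> (ball 0 r)"
    and lift: "\<And>\<tau>. \<tau> \<in> ?H \<Longrightarrow> cmod (u \<tau>) < r \<Longrightarrow> lift_to_half_plane \<Gamma> \<Phi> \<tau> = \<phi> (u \<tau>)"
    using hol unfolding holomorphic_at_inner_def lift_to_half_plane_def u_def by metis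
  have u0: "u \<tau>0 = 0"
    using elliptic_period_pos[OF \<Gamma>, of \<tau>0] \<tau>0 by (simp add: u_def inner_coord_def upper_half_plane_def)
  have "\<tau> \<noteq> cnj \<tau>0" if "\<tau> \<in> ?H" for \<tau>
    using that \<tau>0 by (auto simp: upper_half_plane_def)
  then have u: "u holomorphic_on ?H"
    unfolding u_def inner_coord_def by (intro holomorphic_intros) auto
  have "\<phi> 0 \<noteq> Origin"
    using lift[OF \<tau>0] u0 r fin by simp
  then obtain W where W: "open W" "0 \<in> W" "W \<subseteq> ball 0 r"
    and aff: "\<And>q. q \<in> W \<Longrightarrow> \<phi> q \<noteq> Origin"
    and x: "(\<lambda>q. xcoord (\<phi> q)) holomorphic_on W"
    and y: "(\<lambda>q. ycoord (\<phi> q)) holomorphic_on W"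
    using curve_holomorphic_on_affine_coords[OF \<phi>, of 0] r by (metis centre_in_ball)
  define V where "V = {\<tau> \<in> ?H. u \<tau> \<in> W}"
  have V: "open V" unfolding V_def
    using continuous_open_preimage[OF holomorphic_on_imp_continuous_on[OF u] open_upper_half_plane W(1)]
    by (simp add: vimage_def Int_def)
  have eq: "lift_to_half_plane \<Gamma> \<Phi> \<tau> = \<phi> (u \<tau>)" if "\<tau> \<in> V" for \<tau>
    using that W(3) by (intro lift) (auto simp: V_def)
  have comp: "(\<lambda>\<tau>. h (u \<tau>)) holomorphic_on V" if "h holomorphic_on W" for h :: "complex \<Rightarrow> complex"
    using holomorphic_on_compose_gen[of u V h W] holomorphic_on_subset[OF u, of V] that
    by (auto simp: V_def o_def)
  show thesis
  proof (rule that[OF V])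
    show "\<tau>0 \<in> V" using \<tau>0 u0 W(2) by (simp add: V_def)
    show "V \<subseteq> ?H" by (auto simp: V_def)
    show "lift_to_half_plane \<Gamma> \<Phi> \<tau> \<noteq> Origin" if "\<tau> \<in> V" for \<tau>
      using eq[OF that] aff that by (simp add: V_def)
    show "(\<lambda>\<tau>. xcoord (lift_to_half_plane \<Gamma> \<Phi> \<tau>)) holomorphic_on V"
      using comp[OF x] eq by (simp cong: holomorphic_cong)
    show "(\<lambda>\<tau>. ycoord (lift_to_half_plane \<Gamma> \<Phi> \<tau>)) holomorphic_on V"
      using comp[OF y] eq by (simp cong: holomorphic_cong)
  qed
qed


section \<open>The differential of the \<open>x\<close>-coordinate\<close>

text \<open>A double root \<open>x\<close> would give \<open>p = (X - x)\<^sup>2 (X - s)\<close>, where \<open>s\<close> is read off from the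
  coefficient of \<open>X\<^sup>2\<close>. Expressed by \<open>x\<close> and \<open>s\<close>, the discriminant vanishes identically.\<close>

lemma elliptic_curve_no_double_root:
  assumes "elliptic_curve p" and root: "poly (cpoly p) x = 0"
  shows "poly (pderiv (cpoly p)) x \<noteq> 0"
proof
  assume droot: "poly (pderiv (cpoly p)) x = 0"
  define a b c where "a = coeff p 2" and "b = coeff p 1" and "c = coeff p 0"
  have p: "p = [:c, b, a, 1:]"
  proof (rule poly_eqI)
    fix n
    have "coeff p 3 = 1" "coeff p n = 0" if "n > 3"
      using assms(1) that by (auto simp: elliptic_curve_def coeff_eq_0)
    moreover have "coeff p 3 = 1" using assms(1) by (auto simp: elliptic_curve_def)
    ultimately show "coeff p n = coeff [:c, b, a, 1:] n"
      by (cases "n \<le> 3") (auto simp: a_def b_def c_def numeral_eq_Suc coeff_pCons le_Suc_eq split: nat.splits)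
  qed
  define A B C :: complex where "A = of_rat a" and "B = of_rat b" and "C = of_rat c"
  have "map_poly of_rat p = [:C, B, A, 1::complex:]"
    by (simp add: p map_poly_pCons A_def B_def C_def)
  then have P: "cpoly p = [:C, B, A, 1:]" by (simp add: cpoly_def)
  define s where "s = - A - 2 * x"
  have eqA: "A = - (2 * x + s)" by (simp add: s_def)
  have eqB: "B = x\<^sup>2 + 2 * x * s"
    using droot by (simp add: P pderiv_pCons s_def power2_eq_square) algebra
  have eqC: "C = - (x\<^sup>2 * s)"
    using root by (simp add: P s_def eqB power2_eq_square) algebra
  have "of_rat (weierstrass_disc p) =
     (let b2 = 4 * A; b4 = 2 * B; b6 = 4 * C; b8 = 4 * A * C - B\<^sup>2
      in - b2\<^sup>2 * b8 - 8 * b4 ^ 3 - 27 * b6\<^sup>2 + 9 * b2 * b4 * b6)"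
    by (simp add: weierstrass_disc_def Let_def of_rat_mult of_rat_add of_rat_diff of_rat_minus
        of_rat_power A_def B_def C_def a_def b_def c_def)
  also have "\<dots> = 0"
    unfolding Let_def eqA eqB eqC by algebra
  finally show False
    using assms(1) by (simp add: elliptic_curve_def)
qed

text \<open>Where \<open>y \<noteq> 0\<close> this is the definition of the pullback. Where \<open>y = 0\<close> the right-hand side is
  \<open>0\<close>, and the left-hand side is seen to vanish by differentiating \<open>y\<^sup>2 = p(x)\<close> and dividing by
  \<open>p'(x) \<noteq> 0\<close>.\<close>

lemma deriv_xcoord_eq_pullback:
  assumes p: "elliptic_curve p"
    and V: "open V" "\<tau> \<in> V"
    and aff: "\<And>z. z \<in> V \<Longrightarrow> \<phi> z \<noteq> Origin"
    and curve: "\<And>z. z \<in> V \<Longrightarrow> \<phi> z \<in> curve_points p"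
    and x: "(\<lambda>z. xcoord (\<phi> z)) holomorphic_on V"
    and y: "(\<lambda>z. ycoord (\<phi> z)) holomorphic_on V"
  shows "deriv (\<lambda>z. xcoord (\<phi> z)) \<tau> = 2 * ycoord (\<phi> \<tau>) * pullback_dx_2y p \<phi> \<tau>"
proof (cases "ycoord (\<phi> \<tau>) = 0")
  case False
  with aff[OF V(2)] show ?thesis
    by (cases "\<phi> \<tau>") (simp_all add: pullback_dx_2y_def)
next
  case True
  define X Y where "X = (\<lambda>z. xcoord (\<phi> z))" and "Y = (\<lambda>z. ycoord (\<phi> z))"
  have eq: "Y z ^ 2 = poly (cpoly p) (X z)" if "z \<in> V" for z
    using aff[OF that] curve[OF that] by (auto simp: curve_points_def X_def Y_def)
  have dX: "(X has_field_derivative deriv X \<tau>) (at \<tau>)"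
    and dY: "(Y has_field_derivative deriv Y \<tau>) (at \<tau>)"
    using x y V holomorphic_derivI unfolding X_def Y_def by blast+
  have "((\<lambda>z. Y z ^ 2) has_field_derivative 2 * Y \<tau> * deriv Y \<tau>) (at \<tau>)"
    using dY by (auto intro!: derivative_eq_intros)
  then have "((\<lambda>z. poly (cpoly p) (X z)) has_field_derivative 2 * Y \<tau> * deriv Y \<tau>) (at \<tau>)"
    by (rule DERIV_cong_ev[THEN iffD1, rotated -1])
      (use eq V in \<open>auto intro: eventually_mono[OF eventually_nhds_in_open[OF V]]\<close>)
  moreover have "((\<lambda>z. poly (cpoly p) (X z)) has_field_derivative
      poly (pderiv (cpoly p)) (X \<tau>) * deriv X \<tau>) (at \<tau>)"
    by (rule DERIV_chain2[OF poly_DERIV dX])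
  ultimately have "poly (pderiv (cpoly p)) (X \<tau>) * deriv X \<tau> = 2 * Y \<tau> * deriv Y \<tau>"
    by (rule DERIV_unique[symmetric])
  moreover have "Y \<tau> = 0" using True by (simp add: Y_def)
  moreover have "poly (pderiv (cpoly p)) (X \<tau>) \<noteq> 0"
    using elliptic_curve_no_double_root[OF p] eq[OF V(2)] \<open>Y \<tau> = 0\<close> by simp
  ultimately show ?thesis using True by (simp add: X_def)
qed


section \<open>The modular derivative of \<open>x \<Delta>\<^bsup>4/k\<^esup>\<close>\<close>

text \<open>The operator is a Serre derivative: the correction term removes exactly the derivative of the
  weight factor \<open>\<Delta>\<^bsup>4/k\<^esup>\<close>, so only the derivative of the weight \<open>0\<close> function \<open>x\<close> survives.\<close>

lemma modular_derivative_Q_k: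
  assumes k: "even k" "k > 0"
    and x: "(\<lambda>z. xcoord (\<phi> z)) field_differentiable at \<tau>"
    and g: "rescaled k f field_differentiable at \<tau>"
  shows "modular_derivative k f (Q_k k f \<phi>) \<tau> =
    of_nat k / (8 * of_real pi * \<i>) * deriv (\<lambda>z. xcoord (\<phi> z)) \<tau> * rescaled k f \<tau> ^ 2"
proof -
  define X g where "X = (\<lambda>z. xcoord (\<phi> z))" and "g = rescaled k f"
  obtain m where m: "k = 2 * m" "m > 0" using k by (auto elim: evenE)
  have dX: "(X has_field_derivative deriv X \<tau>) (at \<tau>)"
    and dg: "(g has_field_derivative deriv g \<tau>) (at \<tau>)"
    using x g by (simp_all add: X_def g_def DERIV_deriv_iff_field_differentiable)
  have "((\<lambda>z. X z * g z ^ 2) has_field_derivative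
      deriv X \<tau> * g \<tau> ^ 2 + X \<tau> * (2 * g \<tau> * deriv g \<tau>)) (at \<tau>)"
    using dX dg by (auto intro!: derivative_eq_intros)
  then have dQ: "deriv (Q_k k f \<phi>) \<tau> = deriv X \<tau> * g \<tau> ^ 2 + X \<tau> * (2 * g \<tau> * deriv g \<tau>)"
    by (intro DERIV_imp_deriv) (simp add: Q_k_def[abs_def] Delta_pow_4_k_def X_def g_def)
  have "((\<lambda>z. g z ^ m) has_field_derivative of_nat m * g \<tau> ^ (m - 1) * deriv g \<tau>) (at \<tau>)"
    using dg by (auto intro!: derivative_eq_intros)
  then have dDelta: "deriv (Delta k f) \<tau> = of_nat m * g \<tau> ^ (m - 1) * deriv g \<tau>"
    by (intro DERIV_imp_deriv) (simp add: Delta_def[abs_def] g_def m)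
  have Delta: "Delta k f \<tau> = g \<tau> * g \<tau> ^ (m - 1)"
    using m by (simp add: Delta_def g_def power_eq_if)
  \<comment> \<open>At a zero of \<open>g\<close> the factors \<open>g \<tau>\<close> make both sides vanish, whatever the value of the quotient.\<close>
  have log_deriv: "g \<tau> ^ 2 * (deriv (Delta k f) \<tau> / Delta k f \<tau>) = of_nat m * g \<tau> * deriv g \<tau>"
    unfolding dDelta Delta by (cases "g \<tau> = 0") (simp_all add: power2_eq_square)
  have Q: "Q_k k f \<phi> \<tau> = X \<tau> * g \<tau> ^ 2"
    by (simp add: Q_k_def Delta_pow_4_k_def X_def g_def)
  have "modular_derivative k f (Q_k k f \<phi>) \<tau> =
     of_nat k / (8 * of_real pi * \<i>) * (deriv X \<tau> * g \<tau> ^ 2 + X \<tau> * (2 * g \<tau> * deriv g \<tau>))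
     - 1 / (2 * of_real pi * \<i>) * X \<tau> * (of_nat m * g \<tau> * deriv g \<tau>)"
    unfolding modular_derivative_def Q dQ log_deriv[symmetric] by (simp add: mult.assoc)
  also have "\<dots> = of_nat k / (8 * of_real pi * \<i>) * deriv X \<tau> * g \<tau> ^ 2"
    by (simp add: m field_simps)
  finally show ?thesis by (simp add: X_def g_def)
qed

theorem proposition3:
  fixes N k :: nat
    and a2 a4 a6 b6 c4 d6 :: rat
    and f :: "complex \<Rightarrow> complex"
    and \<Phi> :: "riemann_sphere set \<Rightarrow> curve_point"
  defines "p \<equiv> cubic_k k a2 a4 a6 b6 c4 d6"
    and "\<phi> \<equiv> lift_to_half_plane (Gamma_k N k) \<Phi>"
    and "Q \<equiv> Q_k k f (lift_to_half_plane (Gamma_k N k) \<Phi>)"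
  assumes "N \<ge> 1" and "k \<in> {4, 6, 8, 12}"
    and "elliptic_curve p"
    and "k = 4 \<Longrightarrow> j_invariant p \<noteq> 0 \<and> j_invariant p \<noteq> 1728"
    and "newform (level N k) 2 f" and "rational_fourier_coefficients f"
    and "modular_parametrization (Gamma_k N k) p \<Phi>"
    and "\<And>\<tau>. \<tau> \<in> upper_half_plane \<Longrightarrow>
           pullback_dx_2y p \<phi> \<tau> = 4 * of_real pi * \<i> / of_nat k * f (2 * \<tau> / of_nat k)"
  shows "\<forall>\<tau>\<in>upper_half_plane. \<phi> \<tau> \<noteq> Origin \<longrightarrow>
      (modular_derivative k f Q \<tau>)\<^sup>2 = Delta_pow_12_k k f \<tau> * poly (cpoly p) (xcoord (\<phi> \<tau>)) \<and>
      (k = 4 \<longrightarrow> (modular_derivative k f Q \<tau>)\<^sup>2 =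
         Q \<tau> ^ 3 + of_rat a2 * Q \<tau> ^ 2 * Delta k f \<tau> + of_rat a4 * Q \<tau> * Delta k f \<tau> ^ 2
           + of_rat a6 * Delta k f \<tau> ^ 3) \<and>
      (k = 6 \<longrightarrow> (modular_derivative k f Q \<tau>)\<^sup>2 = Q \<tau> ^ 3 + of_rat b6 * Delta k f \<tau> ^ 2) \<and>
      (k = 8 \<longrightarrow> (modular_derivative k f Q \<tau>)\<^sup>2 = Q \<tau> ^ 3 + of_rat c4 * Q \<tau> * Delta k f \<tau>) \<and>
      (k = 12 \<longrightarrow> (modular_derivative k f Q \<tau>)\<^sup>2 = Q \<tau> ^ 3 + of_rat d6 * Delta k f \<tau>)"
proof (intro ballI impI)
  fix \<tau> assume \<tau>: "\<tau> \<in> upper_half_plane" and fin: "\<phi> \<tau> \<noteq> Origin"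
  let ?\<Gamma> = "Gamma_k N k"
  have k: "even k" "k > 0" using assms(5) by auto
  have lift: "\<phi> = lift_to_half_plane ?\<Gamma> \<Phi>" by (simp add: \<phi>_def)
  note param = assms(10)[unfolded modular_parametrization_def]
  obtain V where V: "open V" "\<tau> \<in> V" "V \<subseteq> upper_half_plane"
    and aff: "\<And>z. z \<in> V \<Longrightarrow> \<phi> z \<noteq> Origin"
    and x: "(\<lambda>z. xcoord (\<phi> z)) holomorphic_on V"
    and y: "(\<lambda>z. ycoord (\<phi> z)) holomorphic_on V"
    using parametrization_affine_coords[of ?\<Gamma> \<Phi> \<tau>] param \<tau> fin
      Gamma_k_subset_SL2Z[OF k] mat_1_in_Gamma_k[OF k] unfolding lift by metis
  have curve: "\<phi> z \<in> curve_points p" if "z \<in> V" for z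
  proof -
    have "orbit ?\<Gamma> (Fin z) \<in> modular_curve ?\<Gamma>"
      using that V(3) by (auto simp: modular_curve_def extended_half_plane_def)
    then show ?thesis using param by (auto simp: lift lift_to_half_plane_def)
  qed
  define g X Y where "g = rescaled k f \<tau>" and "X = xcoord (\<phi> \<tau>)" and "Y = ycoord (\<phi> \<tau>)"
  have dX: "deriv (\<lambda>z. xcoord (\<phi> z)) \<tau> = 2 * Y * (4 * of_real pi * \<i> / of_nat k * g)"
    using deriv_xcoord_eq_pullback[OF assms(6) V(1,2) aff curve x y] assms(11)[OF \<tau>]
    by (simp add: Y_def g_def rescaled_def)
  have "f holomorphic_on upper_half_plane"
    using assms(8) by (simp add: newform_def cusp_forms_def)
  moreover have "2 * z / of_nat k \<in> upper_half_plane" if "z \<in> upper_half_plane" for z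
    using that k by (simp add: upper_half_plane_def)
  ultimately have "(f \<circ> (\<lambda>z. 2 * z / of_nat k)) holomorphic_on upper_half_plane"
    using k by (intro holomorphic_on_compose_gen[where t = upper_half_plane] holomorphic_intros) auto
  then have "rescaled k f holomorphic_on upper_half_plane"
    by (simp add: rescaled_def[abs_def] o_def)
  then have g: "rescaled k f field_differentiable at \<tau>"
    using \<tau> open_upper_half_plane holomorphic_on_imp_differentiable_at by blast
  have "(\<lambda>z. xcoord (\<phi> z)) field_differentiable at \<tau>"
    using x V holomorphic_on_imp_differentiable_at by blast
  then have "modular_derivative k f Q \<tau> = of_nat k / (8 * of_real pi * \<i>) *
      (2 * Y * (4 * of_real pi * \<i> / of_nat k * g)) * g ^ 2"
    using modular_derivative_Q_k[OF k _ g, of \<phi>] dX by (simp add: Q_def lift g_def)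
  also have "\<dots> = Y * g ^ 3"
    using k by (simp add: field_simps power2_eq_square power3_eq_cube)
  finally have "modular_derivative k f Q \<tau> = Y * g ^ 3" .
  then have "(modular_derivative k f Q \<tau>)\<^sup>2 = Y\<^sup>2 * g ^ 6"
    by (simp add: power_mult_distrib flip: power_mult)
  also have "Y\<^sup>2 = poly (cpoly p) X"
    using aff[OF V(2)] curve[OF V(2)] by (auto simp: curve_points_def X_def Y_def)
  finally have main: "(modular_derivative k f Q \<tau>)\<^sup>2 = g ^ 6 * poly (cpoly p) X"
    by (simp add: mult.commute)
  have Q: "Q \<tau> = X * g\<^sup>2"
    by (simp add: Q_def Q_k_def lift Delta_pow_4_k_def X_def g_def)
  have D: "k = 4 \<Longrightarrow> Delta 4 f \<tau> = g ^ 2" "k = 6 \<Longrightarrow> Delta 6 f \<tau> = g ^ 3"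
      "k = 8 \<Longrightarrow> Delta 8 f \<tau> = g ^ 4" "k = 12 \<Longrightarrow> Delta 12 f \<tau> = g ^ 6"
    by (simp_all add: Delta_def g_def)
  have P: "k = 4 \<Longrightarrow> poly (cpoly p) X = of_rat a6 + X * (of_rat a4 + X * (of_rat a2 + X))"
      "k = 6 \<Longrightarrow> poly (cpoly p) X = of_rat b6 + X ^ 3"
      "k = 8 \<Longrightarrow> poly (cpoly p) X = X * (of_rat c4 + X ^ 2)"
      "k = 12 \<Longrightarrow> poly (cpoly p) X = of_rat d6 + X ^ 3"
    by (simp_all add: p_def cubic_k_def cpoly_def map_poly_pCons power2_eq_square power3_eq_cube)
  show "(modular_derivative k f Q \<tau>)\<^sup>2 = Delta_pow_12_k k f \<tau> * poly (cpoly p) (xcoord (\<phi> \<tau>)) \<and>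
      (k = 4 \<longrightarrow> (modular_derivative k f Q \<tau>)\<^sup>2 =
         Q \<tau> ^ 3 + of_rat a2 * Q \<tau> ^ 2 * Delta k f \<tau> + of_rat a4 * Q \<tau> * Delta k f \<tau> ^ 2
           + of_rat a6 * Delta k f \<tau> ^ 3) \<and>
      (k = 6 \<longrightarrow> (modular_derivative k f Q \<tau>)\<^sup>2 = Q \<tau> ^ 3 + of_rat b6 * Delta k f \<tau> ^ 2) \<and>
      (k = 8 \<longrightarrow> (modular_derivative k f Q \<tau>)\<^sup>2 = Q \<tau> ^ 3 + of_rat c4 * Q \<tau> * Delta k f \<tau>) \<and>
      (k = 12 \<longrightarrow> (modular_derivative k f Q \<tau>)\<^sup>2 = Q \<tau> ^ 3 + of_rat d6 * Delta k f \<tau>)"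
    unfolding main
  proof (intro conjI impI)
    show "g ^ 6 * poly (cpoly p) X = Delta_pow_12_k k f \<tau> * poly (cpoly p) (xcoord (\<phi> \<tau>))"
      by (simp add: Delta_pow_12_k_def X_def g_def)
  qed (simp_all add: Q D P, simp_all add: eval_nat_numeral algebra_simps)
qed

end
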